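(* Let $F$ be a baseline distribution function and, for $\alpha\ge 0$, $\beta,\theta>0$, let $G_{\alpha,\beta,\theta}$ be the distribution function whose odds function is $$\Lambda_{G_{\alpha,\beta,\theta}}(x)=\beta\left((\alpha+\Lambda_F(x))^\theta-\alpha^\theta\right).$$ Put $D_{\alpha,\beta,\theta}(x)=\beta(1-\alpha)(\alpha+x)^\theta+(\beta\alpha^\theta-1)(\theta x+\alpha+\theta-1)$ for $x\ge 0$, so that $D_{\alpha,\beta,\theta}(0)=\alpha^\theta\beta\theta-\alpha-(\theta-1)$. Then: 1. If $D_{\alpha,\beta,\theta}(0)<0$, $(1-\alpha)(\theta-1)<0$, and $F$ has increasing hazard rate, then $G_{\alpha,\beta,\theta}$ has increasing hazard rate. 2. If $D_{\alpha,\beta,\theta}(0)>0$, $(1-\alpha)(\theta-1)>0$, and $F$ has decreasing hazard rate, then $G_{\alpha,\beta,\theta}$ has decreasing hazard rate. 3. If ($\alpha=1$ or $\theta=1$), $\beta\le 1$, and $F$ has increasing hazard rate, then $G_{\alpha,\beta,\theta}$ has increasing hazard rate. 4. If ($\alpha=1$ or $\theta=1$), $\beta\ge 1$, and $F$ has decreasing hazard rate, then $G_{\alpha,\beta,\theta}$ has decreasing hazard rate.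
   Context: The baseline $F$ is a distribution function on $\mathbb{R}$ with density $f$; $\overline F=1-F$. For a distribution function $H$ with density $h$, the hazard rate is $h_H=h/\overline H$ and the odds function is $\Lambda_H=H/\overline H=1/\overline H-1$ (equal to $+\infty$ where $\overline H=0$). Thus $\overline G_{\alpha,\beta,\theta}=1-G_{\alpha,\beta,\theta}=\dfrac{1}{1+\beta((\alpha+\Lambda_F)^\theta-\alpha^\theta)}$, with density $g_{\alpha,\beta,\theta}=\beta\theta(\alpha+\Lambda_F)^{\theta-1}\,\overline G_{\alpha,\beta,\theta}^2\, f/\overline F^2$. "Increasing" and "decreasing" are in the weak sense; monotonicity of hazard rates is understood on the set where $0<F<1$ (the support). *)

theory Defs
  imports "HOL-Probability.Probability"
begin

definition distribution_function :: "(real \<Rightarrow> real) \<Rightarrow> bool" where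
  "distribution_function H \<longleftrightarrow> (\<exists>M. real_distribution M \<and> H = cdf M)"

definition has_density :: "(real \<Rightarrow> real) \<Rightarrow> (real \<Rightarrow> real) \<Rightarrow> bool" where
  "has_density H h \<longleftrightarrow>
     h \<in> borel_measurable borel \<and> (\<forall>x. 0 \<le> h x) \<and>
     real_distribution (density lborel (\<lambda>x. ennreal (h x))) \<and>
     H = cdf (density lborel (\<lambda>x. ennreal (h x)))"

definition hazard_rate :: "(real \<Rightarrow> real) \<Rightarrow> (real \<Rightarrow> real) \<Rightarrow> real \<Rightarrow> real" where
  "hazard_rate H h x = h x / (1 - H x)"

text \<open>
  A hazard rate depends on the chosen version \<open>h\<close> of the density, so \<open>h\<close> is an explicit
  argument. That \<open>h\<close> is a density of \<open>H\<close> is part of the property.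
\<close>

definition increasing_hazard_rate :: "(real \<Rightarrow> real) \<Rightarrow> (real \<Rightarrow> real) \<Rightarrow> bool" where
  "increasing_hazard_rate H h \<longleftrightarrow>
     has_density H h \<and> mono_on {x. 0 < H x \<and> H x < 1} (hazard_rate H h)"

definition decreasing_hazard_rate :: "(real \<Rightarrow> real) \<Rightarrow> (real \<Rightarrow> real) \<Rightarrow> bool" where
  "decreasing_hazard_rate H h \<longleftrightarrow>
     has_density H h \<and> antimono_on {x. 0 < H x \<and> H x < 1} (hazard_rate H h)"

definition odds :: "(real \<Rightarrow> real) \<Rightarrow> real \<Rightarrow> ereal" where
  "odds H x = (if H x = 1 then \<infinity> else ereal (H x / (1 - H x)))"

text \<open>
  The map \<open>t \<mapsto> \<beta> ((\<alpha> + t)\<^sup>\<theta> - \<alpha>\<^sup>\<theta>)\<close> on \<open>[0, \<infinity>]\<close>, with value \<open>\<infinity>\<close> at \<open>\<infinity>\<close>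
  (recall \<open>\<beta>, \<theta> > 0\<close>).
\<close>

definition odds_transform :: "real \<Rightarrow> real \<Rightarrow> real \<Rightarrow> ereal \<Rightarrow> ereal" where
  "odds_transform \<alpha> \<beta> \<theta> t =
     (if t = \<infinity> then \<infinity>
      else ereal (\<beta> * ((\<alpha> + real_of_ereal t) powr \<theta> - \<alpha> powr \<theta>)))"

text \<open>
  The density \<open>\<beta> \<theta> (\<alpha> + \<Lambda>)\<^sup>\<theta>\<^sup>-\<^sup>1 (1 - G)\<^sup>2 f / (1 - F)\<^sup>2\<close> of \<open>G\<close>, where \<open>\<Lambda>\<close> is the odds
  function of \<open>F\<close>. Where \<open>F x = 1\<close>, the quotient is \<open>0\<close> because division by zero is \<open>0\<close>;
  the law of \<open>G\<close> gives no mass to this set.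
\<close>

definition transformed_density ::
    "real \<Rightarrow> real \<Rightarrow> real \<Rightarrow> (real \<Rightarrow> real) \<Rightarrow> (real \<Rightarrow> real) \<Rightarrow> (real \<Rightarrow> real) \<Rightarrow> real \<Rightarrow> real" where
  "transformed_density \<alpha> \<beta> \<theta> F f G x =
     \<beta> * \<theta> * (\<alpha> + real_of_ereal (odds F x)) powr (\<theta> - 1) * (1 - G x)\<^sup>2 * f x / (1 - F x)\<^sup>2"

definition D :: "real \<Rightarrow> real \<Rightarrow> real \<Rightarrow> real \<Rightarrow> real" where
  "D \<alpha> \<beta> \<theta> x =
     \<beta> * (1 - \<alpha>) * (\<alpha> + x) powr \<theta> + (\<beta> * \<alpha> powr \<theta> - 1) * (\<theta> * x + \<alpha> + \<theta> - 1)"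

end

(* Write t = F / (1 - F) for the baseline odds. The hazard rate of G is that of F times
   \<beta> \<theta> k(t), where k(t) = (\<alpha> + t)^(\<theta> - 1) (1 + t) / (1 + \<beta> ((\<alpha> + t)^\<theta> - \<alpha>^\<theta>)), and
   k' has the sign of -D. Under the sign condition on (1 - \<alpha>) (\<theta> - 1), D is concave (case 1) or
   convex (case 2), and D(0) fixes the sign of D'(0), hence that of D on [0, \<infinity>).

   That g is a density of G has to be shown although F is only absolutely continuous: F pushes its
   own law forward to the uniform law on (0, 1), so the integral of g over (-\<infinity>, x] becomes the
   integral of \<phi>' over (0, F x), where G = \<phi>(F). This integral is improper at 0 if \<alpha> = 0 and \<theta> < 1. *)
theory Submission
  imports Defs "HOL-Real_Asymp.Real_Asymp"
begin

section \<open>Probability integral transform for laws without atoms\<close>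

text \<open>The inverse satisfies the Galois relation
  \<open>u \<le> C x \<longleftrightarrow> I u \<le> x\<close>. Taking x = I u gives one inequality.
  For the other, C is at most u to the left of I u, and C is left-continuous there because the point
  carries no mass.\<close>

lemma (in real_distribution) cdf_pseudoinverse:
  assumes "\<And>x. measure M {x} = 0" "0 < u" "u < 1"
  shows "cdf M (right_continuous_mono.I (cdf M) u) = u"
proof -
  interpret cdf_distribution M
    by unfold_locales
  have I: "u \<le> C x \<longleftrightarrow> I u \<le> x" for x
    using assms by (intro pseudoinverse) auto
  have "(C \<longlongrightarrow> C (I u)) (at_left (I u))"
    using isCont_cdf[of "I u"] assms(1) by (auto intro: tendsto_within_subset simp: isCont_def)
  moreover have "\<forall>\<^sub>F x in at_left (I u). C x \<le> u"
    unfolding eventually_at_filter using I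
    by (intro always_eventually) (metis lessThan_iff linorder_not_le nle_le)
  ultimately have "C (I u) \<le> u"
    by (intro tendsto_upperbound) auto
  then show ?thesis
    using iffD2[OF I order.refl] by (rule antisym)
qed

text \<open>A substitution u = C t that needs no differentiability of C: M is the image under I of
  the uniform law on (0,1), and C undoes I by the preceding lemma.\<close>

lemma (in real_distribution) nn_integral_cdf_atMost:
  assumes no_atoms: "\<And>x. measure M {x} = 0" and [measurable]: "h \<in> borel_measurable borel"
  shows "(\<integral>\<^sup>+t. h (cdf M t) * indicator {..x} t \<partial>M) =
         (\<integral>\<^sup>+u. h u * indicator {0<..<cdf M x} u \<partial>lborel)"
proof -
  interpret cdf_distribution M
    by unfold_locales
  let ?U = "restrict_space lborel {0<..<1::real}"
  have [measurable]: "I \<in> borel_measurable ?U"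
    using measurable_CI by (simp cong: measurable_cong_sets add: sets_restrict_space)
  have "(\<integral>\<^sup>+t. h (C t) * indicator {..x} t \<partial>M) =
        (\<integral>\<^sup>+t. h (C t) * indicator {..x} t \<partial>distr ?U borel I)"
    by (simp add: distr_I_eq_M)
  also have "\<dots> = (\<integral>\<^sup>+u. h (C (I u)) * indicator {..x} (I u) \<partial>?U)"
    by (rule nn_integral_distr) measurable
  also have "\<dots> = (\<integral>\<^sup>+u. h (C (I u)) * indicator {..x} (I u) * indicator {0<..<1} u \<partial>lborel)"
    by (rule nn_integral_restrict_space) simp
  also have "\<dots> = (\<integral>\<^sup>+u. h u * indicator {0<..<C x} u \<partial>lborel)"
  proof (rule nn_integral_cong_AE)
    show "AE u in lborel. h (C (I u)) * indicator {..x} (I u) * indicator {0<..<1} u =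
            h u * indicator {0<..<C x} u"
      \<comment> \<open>The event \<open>I u \<le> x\<close> is \<open>u \<le> C x\<close>, whereas
        the target interval is open at C x; the single point u = C x is discarded as a null
        set.\<close>
      using AE_lborel_singleton[of "C x"]
    proof eventually_elim
      case (elim u)
      show ?case
        using elim cdf_pseudoinverse[OF no_atoms, of u] pseudoinverse[of u x] cdf_bounded_prob[of x]
        by (auto simp: indicator_def)
    qed
  qed
  finally show ?thesis .
qed

section \<open>Densities and their distribution functions\<close>

lemma has_densityD:
  assumes "has_density H h"
  shows "h \<in> borel_measurable borel" "\<And>x. 0 \<le> h x"
    "real_distribution (density lborel (\<lambda>x. ennreal (h x)))"
    "H = cdf (density lborel (\<lambda>x. ennreal (h x)))"
  using assms by (auto simp: has_density_def)

lemma has_density_imp_measurable: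
  assumes "has_density H h"
  shows "H \<in> borel_measurable borel"
proof -
  interpret cdf_distribution "density lborel (\<lambda>x. ennreal (h x))"
    using assms by (simp add: cdf_distribution_def has_densityD)
  show ?thesis
    using measurable_C has_densityD(4)[OF assms] by simp
qed

text \<open>Total mass 1 is not assumed for h: exhausting the line by half-lines yields it, since H
  tends to 1 at infinity as a distribution function.\<close>

lemma has_densityI:
  assumes "distribution_function H" and [measurable]: "h \<in> borel_measurable borel"
    and nonneg: "\<And>x. 0 \<le> h x"
    and eq: "\<And>x. (\<integral>\<^sup>+t. ennreal (h t) * indicator {..x} t \<partial>lborel) = ennreal (H x)"
  shows "has_density H h"
proof -
  obtain N where N: "real_distribution N" "H = cdf N"
    using assms(1) by (auto simp: distribution_function_def)
  interpret N: real_distribution N by fact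
  let ?M = "density lborel (\<lambda>x. ennreal (h x))"
  have emeasure: "emeasure ?M {..x} = ennreal (H x)" for x
    using eq[of x] by (simp add: emeasure_density)
  have "(\<lambda>n. emeasure ?M {..real n}) \<longlonglongrightarrow> emeasure ?M (\<Union>n. {..real n})"
    by (intro Lim_emeasure_incseq) (auto simp: incseq_def)
  moreover have "(\<Union>n. {..real n}) = UNIV"
    by (auto simp: real_arch_simple)
  moreover have "(\<lambda>n. emeasure ?M {..real n}) \<longlonglongrightarrow> ennreal 1"
    unfolding emeasure N(2) by (intro tendsto_ennrealI N.cdf_lim_infty_prob)
  ultimately have "emeasure ?M UNIV = 1"
    using LIMSEQ_unique by force
  then have "real_distribution ?M"
    by (intro real_distribution.intro prob_spaceI real_distribution_axioms.intro) simp_all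
  moreover have "H = cdf ?M"
    using emeasure N.cdf_nonneg by (auto simp: cdf_def measure_def N(2))
  ultimately show ?thesis
    using nonneg by (auto simp: has_density_def)
qed

section \<open>The transform as a function of F and of its odds\<close>

text \<open>With t the odds of F, this is 1 / (1 - G), because 1 / (1 - G) is one plus the odds of
  G.\<close>

definition odds_denom :: "real \<Rightarrow> real \<Rightarrow> real \<Rightarrow> real \<Rightarrow> real" where
  "odds_denom \<alpha> \<beta> \<theta> t = 1 + \<beta> * ((\<alpha> + t) powr \<theta> - \<alpha> powr \<theta>)"

text \<open>Division by zero makes the value at \<open>u = 1\<close> equal to \<open>0\<close>; the limit there is \<open>1\<close>.\<close>

definition tilt :: "real \<Rightarrow> real \<Rightarrow> real \<Rightarrow> real \<Rightarrow> real" where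
  "tilt \<alpha> \<beta> \<theta> u = 1 - 1 / odds_denom \<alpha> \<beta> \<theta> (u / (1 - u))"

text \<open>The formula for g with F x = u and the factor f removed. The last divisor comes from the
  derivative 1 / (1 - u)^2 of the odds u / (1 - u).\<close>

definition tilt_deriv :: "real \<Rightarrow> real \<Rightarrow> real \<Rightarrow> real \<Rightarrow> real" where
  "tilt_deriv \<alpha> \<beta> \<theta> u =
     \<beta> * \<theta> * (\<alpha> + u / (1 - u)) powr (\<theta> - 1) / (odds_denom \<alpha> \<beta> \<theta> (u / (1 - u)))\<^sup>2 / (1 - u)\<^sup>2"

text \<open>The factor k, where 1 + t stands for 1 / (1 - F).\<close>

definition hazard_factor :: "real \<Rightarrow> real \<Rightarrow> real \<Rightarrow> real \<Rightarrow> real" where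
  "hazard_factor \<alpha> \<beta> \<theta> t = (\<alpha> + t) powr (\<theta> - 1) * (1 + t) / odds_denom \<alpha> \<beta> \<theta> t"

lemma hazard_factor_nonneg:
  "0 \<le> hazard_factor \<alpha> \<beta> \<theta> t" if "0 \<le> t" "0 < odds_denom \<alpha> \<beta> \<theta> t"
  using that by (simp add: hazard_factor_def)

context
  fixes \<alpha> \<beta> \<theta> :: real
  assumes \<alpha>: "0 \<le> \<alpha>" and \<beta>: "0 < \<beta>" and \<theta>: "0 < \<theta>"
begin

lemma odds_denom_ge_1:
  assumes "0 \<le> t"
  shows "1 \<le> odds_denom \<alpha> \<beta> \<theta> t"
  using assms \<alpha> \<beta> \<theta> by (simp add: odds_denom_def powr_mono2)

lemma DERIV_odds_denom:
  assumes "0 < t"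
  shows "(odds_denom \<alpha> \<beta> \<theta> has_real_derivative \<beta> * \<theta> * (\<alpha> + t) powr (\<theta> - 1)) (at t)"
  unfolding odds_denom_def using assms \<alpha>
  by (auto intro!: derivative_eq_intros simp: powr_diff)

lemma DERIV_tilt:
  assumes "0 < u" "u < 1"
  shows "(tilt \<alpha> \<beta> \<theta> has_real_derivative tilt_deriv \<alpha> \<beta> \<theta> u) (at u)"
proof -
  have pos: "0 < u / (1 - u)"
    using assms by simp
  have "((\<lambda>u. u / (1 - u)) has_real_derivative 1 / (1 - u)\<^sup>2) (at u)"
    using assms by (auto intro!: derivative_eq_intros simp: power2_eq_square)
  from DERIV_chain2[OF DERIV_odds_denom[OF pos] this] show ?thesis
    unfolding tilt_def tilt_deriv_def using odds_denom_ge_1[of "u / (1 - u)"] pos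
    by (auto intro!: derivative_eq_intros simp: power2_eq_square)
qed

lemma isCont_tilt_deriv:
  assumes "0 < u" "u < 1"
  shows "isCont (tilt_deriv \<alpha> \<beta> \<theta>) u"
proof -
  have pos: "0 < u / (1 - u)"
    using assms by simp
  have "0 < \<alpha> + u / (1 - u)"
    using pos \<alpha> by simp
  then show ?thesis
    unfolding tilt_deriv_def odds_denom_def
    using odds_denom_ge_1[of "u / (1 - u)"] pos assms
    by (auto intro!: continuous_intros simp: odds_denom_def)
qed

lemma tendsto_tilt_0: "(tilt \<alpha> \<beta> \<theta> \<longlongrightarrow> 0) (at_right 0)"
proof -
  have "((\<lambda>u. (\<alpha> + u / (1 - u)) powr \<theta>) \<longlongrightarrow> (\<alpha> + 0 / (1 - 0)) powr \<theta>) (at_right 0)"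
    (is "(?p \<longlongrightarrow> _) _")
  \<comment> \<open>If \<alpha> = 0, the base tends to 0. The limit then rests on \<theta> > 0 and
    on the base being nonnegative near 0, and its value uses that 0 \<open>powr\<close> \<theta> is
    0.\<close>
  proof (rule tendsto_powr')
    have "\<forall>\<^sub>F u in at_right 0. u \<in> {0<..<1::real}"
      by (rule eventually_at_right_real) simp
    then have "\<forall>\<^sub>F u in at_right 0. 0 \<le> \<alpha> + u / (1 - u)"
      by (rule eventually_mono) (use \<alpha> in auto)
    then show "\<alpha> + 0 / (1 - 0) \<noteq> 0 \<or> 0 < \<theta> \<and> (\<forall>\<^sub>F u in at_right 0. 0 \<le> \<alpha> + u / (1 - u))"
      using \<theta> by auto
  qed (auto intro!: tendsto_eq_intros)
  then have "(?p \<longlongrightarrow> \<alpha> powr \<theta>) (at_right 0)"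
    by simp
  then have "((\<lambda>u. 1 - 1 / (1 + \<beta> * (?p u - \<alpha> powr \<theta>))) \<longlongrightarrow>
      1 - 1 / (1 + \<beta> * (\<alpha> powr \<theta> - \<alpha> powr \<theta>))) (at_right 0)"
    by (intro tendsto_diff tendsto_const tendsto_divide tendsto_add tendsto_mult) auto
  then show ?thesis
    unfolding tilt_def[abs_def] odds_denom_def by simp
qed

lemma tendsto_tilt_1: "(tilt \<alpha> \<beta> \<theta> \<longlongrightarrow> 1) (at_left 1)"
  unfolding tilt_def odds_denom_def using \<alpha> \<beta> \<theta> by real_asymp

text \<open>For \<theta> < 1 the integrand is unbounded near 1, and if also \<alpha> = 0, near 0. So
  the fundamental theorem is used with one-sided limits at the endpoints; nonnegativity of the
  integrand gives integrability. At u = 1 the limit 1 replaces the default value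
  \<open>tilt \<alpha> \<beta> \<theta> 1 = 0\<close>.\<close>

lemma nn_integral_tilt_deriv:
  assumes "0 < u" "u \<le> 1"
  shows "(\<integral>\<^sup>+v. ennreal (tilt_deriv \<alpha> \<beta> \<theta> v) * indicator {0<..<u} v \<partial>lborel) =
         ennreal (if u = 1 then 1 else tilt \<alpha> \<beta> \<theta> u)"
proof -
  let ?L = "if u = 1 then 1 else tilt \<alpha> \<beta> \<theta> u"
  have ev: "\<forall>\<^sub>F v in at_left u. v \<in> {0<..<u}"
    using assms by (intro eventually_at_left_real)
  have lim: "(tilt \<alpha> \<beta> \<theta> \<longlongrightarrow> ?L) (at_left u)"
  proof (cases "u = 1")
    case False
    then have "isCont (tilt \<alpha> \<beta> \<theta>) u"
      using assms by (intro DERIV_isCont[OF DERIV_tilt]) auto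
    with False show ?thesis
      by (auto simp: isCont_def intro: tendsto_within_subset)
  qed (use tendsto_tilt_1 in simp)
  have nonneg: "0 \<le> tilt_deriv \<alpha> \<beta> \<theta> v" for v
    using \<beta> \<theta> by (simp add: tilt_deriv_def)
  \<comment> \<open>The interval integral has extended real endpoints, so the two limits are
    restated on that line.\<close>
  have "((tilt \<alpha> \<beta> \<theta> \<circ> real_of_ereal) \<longlongrightarrow> 0) (at_right (ereal 0))"
    "((tilt \<alpha> \<beta> \<theta> \<circ> real_of_ereal) \<longlongrightarrow> ?L) (at_left (ereal u))"
    using tendsto_tilt_0 lim by (simp_all only: ereal_tendsto_simps)
  note FTC = interval_integral_FTC_nonneg[OF _ DERIV_tilt isCont_tilt_deriv _ this]
  have set_eq: "einterval (ereal 0) (ereal u) = {0<..<u}"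
    by (auto simp: einterval_def)
  have int: "set_integrable lborel {0<..<u} (tilt_deriv \<alpha> \<beta> \<theta>)"
    using FTC(1) assms nonneg by (simp add: set_eq)
  have val: "(LINT v:{0<..<u}|lborel. tilt_deriv \<alpha> \<beta> \<theta> v) = ?L"
    using FTC(2) assms nonneg by (simp add: interval_lebesgue_integral_def set_eq)
  have "(\<integral>\<^sup>+v. ennreal (tilt_deriv \<alpha> \<beta> \<theta> v) * indicator {0<..<u} v \<partial>lborel) =
        (\<integral>\<^sup>+v. ennreal (indicator {0<..<u} v *\<^sub>R tilt_deriv \<alpha> \<beta> \<theta> v) \<partial>lborel)"
    by (intro nn_integral_cong) (auto simp: indicator_def)
  also have "\<dots> = ennreal ?L"
    using int nonneg val
    by (subst nn_integral_eq_integral)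
       (auto simp: set_integrable_def set_lebesgue_integral_def indicator_def)
  finally show ?thesis .
qed

section \<open>Monotonicity of the hazard factor\<close>

text \<open>Factor (\<alpha> + t)^(\<theta> - 2) out of the quotient rule's numerator. In what
  remains, \<beta> (\<alpha> + t)^\<theta> has coefficient (\<theta> - 1)(1 + t) + (\<alpha> + t) -
  \<theta>(1 + t) = \<alpha> - 1, and the rest is (1 - \<beta> \<alpha>^\<theta>)(\<theta> t +
  \<alpha> + \<theta> - 1). The sum is -D.\<close>

lemma DERIV_hazard_factor:
  assumes "0 < t"
  shows "(hazard_factor \<alpha> \<beta> \<theta> has_real_derivative
           (\<alpha> + t) powr (\<theta> - 2) * (- D \<alpha> \<beta> \<theta> t) / (odds_denom \<alpha> \<beta> \<theta> t)\<^sup>2) (at t)"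
proof -
  have pos: "0 < \<alpha> + t" "0 < odds_denom \<alpha> \<beta> \<theta> t"
    using assms \<alpha> odds_denom_ge_1[of t] by auto
  \<comment> \<open>Writing every power of \<alpha> + t through p turns the identity into a
    polynomial one.\<close>
  define p where "p = (\<alpha> + t) powr (\<theta> - 2)"
  have p1: "(\<alpha> + t) powr (\<theta> - 1) = (\<alpha> + t) * p"
    using pos powr_add[of "\<alpha> + t" 1 "\<theta> - 2"] by (simp add: p_def)
  have p2: "(\<alpha> + t) powr \<theta> = (\<alpha> + t) * ((\<alpha> + t) * p)"
    using pos powr_add[of "\<alpha> + t" 1 "\<theta> - 1"] by (simp add: p1)
  have "((\<lambda>t. (\<alpha> + t) powr (\<theta> - 1)) has_real_derivative (\<theta> - 1) * p) (at t)"
    using pos by (auto intro!: derivative_eq_intros simp: p_def)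
  from DERIV_divide[OF DERIV_mult[OF this DERIV_add[OF DERIV_const DERIV_ident]]
      DERIV_odds_denom[OF assms], of 1]
  show ?thesis
    unfolding hazard_factor_def
  proof (rule DERIV_cong, goal_cases)
    case 1
    then show ?case using pos by simp
  next
    case 2
    have "((\<theta> - 1) * p * (1 + t) + (0 + 1) * ((\<alpha> + t) * p)) * odds_denom \<alpha> \<beta> \<theta> t
        - (\<alpha> + t) * p * (1 + t) * (\<beta> * \<theta> * ((\<alpha> + t) * p)) = p * (- D \<alpha> \<beta> \<theta> t)"
      by (simp add: D_def odds_denom_def p2 algebra_simps)
    then show ?case
      unfolding p1 p_def[symmetric] by (simp add: power2_eq_square)
  qed
qed

lemma hazard_factor_mono:
  assumes D: "\<And>t. 0 < t \<Longrightarrow> D \<alpha> \<beta> \<theta> t \<le> 0" and "0 < s" "s \<le> t"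
  shows "hazard_factor \<alpha> \<beta> \<theta> s \<le> hazard_factor \<alpha> \<beta> \<theta> t"
proof (rule DERIV_nonneg_imp_nondecreasing[OF \<open>s \<le> t\<close>])
  fix x assume "s \<le> x" "x \<le> t"
  with \<open>0 < s\<close> have x: "0 < x"
    by simp
  have "0 \<le> (\<alpha> + x) powr (\<theta> - 2) * (- D \<alpha> \<beta> \<theta> x) / (odds_denom \<alpha> \<beta> \<theta> x)\<^sup>2"
    using D[OF x] by (intro divide_nonneg_nonneg mult_nonneg_nonneg) auto
  with DERIV_hazard_factor[OF x]
  show "\<exists>y. (hazard_factor \<alpha> \<beta> \<theta> has_real_derivative y) (at x) \<and> 0 \<le> y"
    by blast
qed

lemma hazard_factor_antimono:
  assumes D: "\<And>t. 0 < t \<Longrightarrow> 0 \<le> D \<alpha> \<beta> \<theta> t" and "0 < s" "s \<le> t"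
  shows "hazard_factor \<alpha> \<beta> \<theta> t \<le> hazard_factor \<alpha> \<beta> \<theta> s"
proof (rule DERIV_nonpos_imp_nonincreasing[OF \<open>s \<le> t\<close>])
  fix x assume "s \<le> x" "x \<le> t"
  with \<open>0 < s\<close> have x: "0 < x"
    by simp
  have "(\<alpha> + x) powr (\<theta> - 2) * (- D \<alpha> \<beta> \<theta> x) / (odds_denom \<alpha> \<beta> \<theta> x)\<^sup>2 \<le> 0"
    using D[OF x] by (intro divide_nonpos_nonneg mult_nonneg_nonpos) auto
  with DERIV_hazard_factor[OF x]
  show "\<exists>y. (hazard_factor \<alpha> \<beta> \<theta> has_real_derivative y) (at x) \<and> y \<le> 0"
    by blast
qed

section \<open>The sign of D\<close>

lemma D_0: "D \<alpha> \<beta> \<theta> 0 = \<alpha> powr \<theta> * \<beta> * \<theta> - \<alpha> - (\<theta> - 1)"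
  by (simp add: D_def algebra_simps)

lemma DERIV_D:
  assumes "0 < \<alpha> + t"
  shows "(D \<alpha> \<beta> \<theta> has_real_derivative
           \<theta> * (\<beta> * ((1 - \<alpha>) * (\<alpha> + t) powr (\<theta> - 1)) + (\<beta> * \<alpha> powr \<theta> - 1))) (at t)"
  unfolding D_def using assms
  by (auto intro!: derivative_eq_intros simp: algebra_simps)

lemma powr_minus_one_mult: "\<alpha> powr \<theta> = \<alpha> * \<alpha> powr (\<theta> - 1)"
  using powr_mult_base[OF \<alpha>, of "\<theta> - 1"] by simp

text \<open>D decreases from its negative value at 0: its slope there is \<theta> (\<beta>
  \<alpha>^(\<theta> - 1) - 1), which turns out negative, and the slope at s > 0 is no
  larger.\<close>

lemma D_le_0:
  assumes D0: "D \<alpha> \<beta> \<theta> 0 < 0" and sgn: "(1 - \<alpha>) * (\<theta> - 1) < 0" and t: "0 < t"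
  shows "D \<alpha> \<beta> \<theta> t \<le> 0"
proof -
  \<comment> \<open>If \<alpha> = 0, the sign condition gives \<theta> < 1, but then D(0) = 1 -
    \<theta> > 0.\<close>
  have "\<alpha> \<noteq> 0"
    using D0 sgn \<theta> by (auto simp: D_0)
  with \<alpha> have \<alpha>: "0 < \<alpha>" by simp
  \<comment> \<open>D(0) < 0 bounds the left side by \<alpha> + \<theta> - 1, and \<alpha> \<theta>
    - (\<alpha> + \<theta> - 1) = -(1 - \<alpha>)(\<theta> - 1) > 0.\<close>
  have "\<beta> * \<alpha> powr (\<theta> - 1) * (\<alpha> * \<theta>) < 1 * (\<alpha> * \<theta>)"
    using D0 sgn by (simp add: D_0 powr_minus_one_mult algebra_simps)
  then have slope: "\<beta> * \<alpha> powr (\<theta> - 1) < 1"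
    using \<alpha> \<theta> by (simp only: mult_less_cancel_right_pos mult_pos_pos)
  have "D \<alpha> \<beta> \<theta> t \<le> D \<alpha> \<beta> \<theta> 0"
  proof (rule DERIV_nonpos_imp_nonincreasing[where f = "D \<alpha> \<beta> \<theta>"])
    fix s assume s: "0 \<le> s" "s \<le> t"
    have "(1 - \<alpha>) * (\<alpha> + s) powr (\<theta> - 1) \<le> (1 - \<alpha>) * \<alpha> powr (\<theta> - 1)"
    \<comment> \<open>The sign condition forces \<theta> < 1 when \<alpha> < 1 and \<theta> > 1
      otherwise, so the direction of the power and the sign of 1 - \<alpha> change together.\<close>
    proof (cases "\<alpha> < 1")
      case True
      with sgn \<alpha> s show ?thesis
        by (intro mult_left_mono powr_mono2') (auto simp: mult_less_0_iff)
    next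
      case False
      with sgn \<alpha> s show ?thesis
        by (intro mult_left_mono_neg powr_mono2) (auto simp: mult_less_0_iff)
    qed
    then have "\<beta> * ((1 - \<alpha>) * (\<alpha> + s) powr (\<theta> - 1)) \<le> \<beta> * ((1 - \<alpha>) * \<alpha> powr (\<theta> - 1))"
      using \<beta> by simp
    also have "\<dots> \<le> 1 - \<beta> * \<alpha> powr \<theta>"
      using slope by (simp add: powr_minus_one_mult algebra_simps)
    finally show "\<exists>y. (D \<alpha> \<beta> \<theta> has_real_derivative y) (at s) \<and> y \<le> 0"
      using DERIV_D[of s] \<alpha> s \<theta> by (intro exI conjI, force) (auto intro!: mult_nonneg_nonpos)
  qed (use t in simp)
  with D0 show ?thesis by simp
qed

text \<open>The mirror image of \<open>D_le_0\<close>: now \<alpha> + \<theta> - 1 > \<alpha>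
  \<theta>, so D(0) > 0 makes the slope at 0 positive, and it stays at least as large. For \<alpha>
  = 0 one would have D(0) = 1 - \<theta> < 0.\<close>

lemma D_ge_0:
  assumes D0: "0 < D \<alpha> \<beta> \<theta> 0" and sgn: "0 < (1 - \<alpha>) * (\<theta> - 1)" and t: "0 < t"
  shows "0 \<le> D \<alpha> \<beta> \<theta> t"
proof -
  have "\<alpha> \<noteq> 0"
    using D0 sgn \<theta> by (auto simp: D_0)
  with \<alpha> have \<alpha>: "0 < \<alpha>" by simp
  have "1 * (\<alpha> * \<theta>) < \<beta> * \<alpha> powr (\<theta> - 1) * (\<alpha> * \<theta>)"
    using D0 sgn by (simp add: D_0 powr_minus_one_mult algebra_simps)
  then have slope: "1 < \<beta> * \<alpha> powr (\<theta> - 1)"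
    using \<alpha> \<theta> by (simp only: mult_less_cancel_right_pos mult_pos_pos)
  have "D \<alpha> \<beta> \<theta> 0 \<le> D \<alpha> \<beta> \<theta> t"
  proof (rule DERIV_nonneg_imp_nondecreasing[where f = "D \<alpha> \<beta> \<theta>"])
    fix s assume s: "0 \<le> s" "s \<le> t"
    have "(1 - \<alpha>) * \<alpha> powr (\<theta> - 1) \<le> (1 - \<alpha>) * (\<alpha> + s) powr (\<theta> - 1)"
    proof (cases "\<alpha> < 1")
      case True
      with sgn \<alpha> s show ?thesis
        by (intro mult_left_mono powr_mono2) (auto simp: zero_less_mult_iff)
    next
      case False
      with sgn \<alpha> s show ?thesis
        by (intro mult_left_mono_neg powr_mono2') (auto simp: zero_less_mult_iff)
    qed
    then have "\<beta> * ((1 - \<alpha>) * \<alpha> powr (\<theta> - 1)) \<le> \<beta> * ((1 - \<alpha>) * (\<alpha> + s) powr (\<theta> - 1))"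
      using \<beta> by simp
    moreover have "1 - \<beta> * \<alpha> powr \<theta> \<le> \<beta> * ((1 - \<alpha>) * \<alpha> powr (\<theta> - 1))"
      using slope by (simp add: powr_minus_one_mult algebra_simps)
    ultimately show "\<exists>y. (D \<alpha> \<beta> \<theta> has_real_derivative y) (at s) \<and> 0 \<le> y"
      using DERIV_D[of s] \<alpha> s \<theta> by (intro exI conjI, force) (auto intro!: mult_nonneg_nonneg)
  qed (use t in simp)
  with D0 show ?thesis by simp
qed

text \<open>If \<alpha> = 1, the first summand of D vanishes and \<alpha>^\<theta> = 1; if \<theta>
  = 1, both summands contain \<alpha> + t. In these cases \<beta> - 1 alone decides the sign of D,
  the other factor being nonnegative.\<close>

lemma D_boundary:
  assumes "\<alpha> = 1 \<or> \<theta> = 1" "0 < t"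
  shows "D \<alpha> \<beta> \<theta> t = (\<beta> - 1) * (\<theta> * t + \<alpha> + \<theta> - 1)"
  using assms \<alpha> by (auto simp: D_def algebra_simps)

lemma D_boundary_factor_nonneg:
  assumes "\<alpha> = 1 \<or> \<theta> = 1" "0 < t"
  shows "0 \<le> \<theta> * t + \<alpha> + \<theta> - 1"
  using assms \<alpha> \<theta> by auto

section \<open>The density and the hazard rate of G\<close>

context
  fixes F f G g :: "real \<Rightarrow> real"
  assumes F: "has_density F f"
    and G: "distribution_function G"
    and odds: "\<And>x. odds G x = odds_transform \<alpha> \<beta> \<theta> (odds F x)"
    and g: "g = transformed_density \<alpha> \<beta> \<theta> F f G"
begin

lemma F_bounds: "0 \<le> F x" "F x \<le> 1" and mono_F: "mono F"
proof -
  interpret F: real_distribution "density lborel (\<lambda>x. ennreal (f x))"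
    using F by (rule has_densityD)
  show "0 \<le> F x" "F x \<le> 1" "mono F"
    unfolding has_densityD(4)[OF F]
    by (auto intro: F.cdf_nonneg F.cdf_bounded_prob F.cdf_nondecreasing monoI)
qed

lemma G_eq_1: "F x = 1 \<Longrightarrow> G x = 1"
  using odds[of x] by (auto simp: odds_def odds_transform_def split: if_splits)

lemma G_eq_tilt:
  assumes "F x < 1"
  shows "G x = tilt \<alpha> \<beta> \<theta> (F x)"
proof -
  have "1 \<le> odds_denom \<alpha> \<beta> \<theta> (F x / (1 - F x))"
    using assms F_bounds(1)[of x] by (intro odds_denom_ge_1) auto
  \<comment> \<open>Finite odds of F give finite odds of G, which excludes G x = 1 and allows
    solving for G x.\<close>
  moreover have "G x \<noteq> 1" "G x / (1 - G x) = odds_denom \<alpha> \<beta> \<theta> (F x / (1 - F x)) - 1"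
    using odds[of x] assms
    by (auto simp: odds_def odds_transform_def odds_denom_def split: if_splits)
  ultimately show ?thesis
    by (simp add: tilt_def field_simps)
qed

lemma G_eq_0: "F x = 0 \<Longrightarrow> G x = 0"
  by (simp add: G_eq_tilt tilt_def odds_denom_def)

text \<open>Formally the chain rule for G = \<open>tilt\<close> composed with F, but obtained from
  the formula for g alone, as F need not be differentiable.\<close>

lemma g_eq:
  assumes "F x < 1"
  shows "g x = tilt_deriv \<alpha> \<beta> \<theta> (F x) * f x"
  using assms by (simp add: g transformed_density_def tilt_deriv_def G_eq_tilt tilt_def odds_def
      power_divide)

lemma has_density_G: "has_density G g"
proof (rule has_densityI[OF G])
  let ?M = "density lborel (\<lambda>x. ennreal (f x))"
  let ?\<psi> = "\<lambda>u. if u < 1 then tilt_deriv \<alpha> \<beta> \<theta> u else 0"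
  interpret F: real_distribution ?M
    using F by (rule has_densityD)
  note [measurable] = has_densityD(1)[OF F] has_density_imp_measurable[OF F]
  have [measurable]: "tilt_deriv \<alpha> \<beta> \<theta> \<in> borel_measurable borel"
    unfolding tilt_deriv_def[abs_def] odds_denom_def by measurable
  \<comment> \<open>Where F x = 1, the formula for g divides by zero and so gives 0, in agreement
    with \<open>?\<psi>\<close>.\<close>
  have g_eq': "g = (\<lambda>x. ?\<psi> (F x) * f x)"
  proof
    fix x show "g x = ?\<psi> (F x) * f x"
      using g_eq[of x] F_bounds[of x]
      by (cases "F x < 1") (auto simp: g transformed_density_def)
  qed
  show "g \<in> borel_measurable borel"
    unfolding g_eq' by measurable
  show "0 \<le> g x" for x
    unfolding g_eq' using has_densityD(2)[OF F] \<beta> \<theta> by (simp add: tilt_deriv_def)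
  fix x
  \<comment> \<open>The factor f is absorbed into the measure, so that the integral is taken against
    the law of F and depends on t through F t and the half-line only.\<close>
  have "(\<integral>\<^sup>+t. ennreal (g t) * indicator {..x} t \<partial>lborel) =
        (\<integral>\<^sup>+t. ennreal (f t) * (ennreal (?\<psi> (F t)) * indicator {..x} t) \<partial>lborel)"
    unfolding g_eq' by (simp only: ennreal_mult''[OF has_densityD(2)[OF F]]) (simp only: mult_ac)
  also have "\<dots> = (\<integral>\<^sup>+t. ennreal (?\<psi> (F t)) * indicator {..x} t \<partial>?M)"
    by (subst nn_integral_density) auto
  also have "\<dots> = (\<integral>\<^sup>+u. ennreal (?\<psi> u) * indicator {0<..<F x} u \<partial>lborel)"
  proof -
    have "emeasure ?M {y} = 0" for y
      by (auto simp: emeasure_density intro!: nn_integral_null_set)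
    then have "measure ?M {y} = 0" for y
      by (simp add: measure_def)
    from F.nn_integral_cdf_atMost[OF this, of "\<lambda>u. ennreal (?\<psi> u)" x] show ?thesis
      unfolding has_densityD(4)[OF F, symmetric] by measurable
  qed
  also have "\<dots> = (\<integral>\<^sup>+u. ennreal (tilt_deriv \<alpha> \<beta> \<theta> u) * indicator {0<..<F x} u \<partial>lborel)"
    using F_bounds(2)[of x] by (intro nn_integral_cong) (auto simp: indicator_def)
  \<comment> \<open>For F x = 0 the interval is empty and G x = 0; for F x = 1 the limit value 1
    equals G x.\<close>
  also have "\<dots> = ennreal (G x)"
    using F_bounds[of x] nn_integral_tilt_deriv[of "F x"] G_eq_1[of x] G_eq_0[of x] G_eq_tilt[of x]
    by (cases "F x = 0") auto
  finally show "(\<integral>\<^sup>+t. ennreal (g t) * indicator {..x} t \<partial>lborel) = ennreal (G x)" .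
qed

lemma support_G: "0 < G x \<and> G x < 1 \<Longrightarrow> 0 < F x \<and> F x < 1"
  using G_eq_0[of x] G_eq_1[of x] F_bounds[of x] by (force simp: order_less_le)

lemma hazard_rate_G:
  assumes "0 < F x" "F x < 1"
  shows "hazard_rate G g x =
         \<beta> * \<theta> * (hazard_factor \<alpha> \<beta> \<theta> (F x / (1 - F x)) * hazard_rate F f x)"
proof -
  have "1 \<le> odds_denom \<alpha> \<beta> \<theta> (F x / (1 - F x))"
    using assms by (intro odds_denom_ge_1) auto
  \<comment> \<open>Of the two factors 1 / (1 - F) in g, one becomes the 1 + t of k and the other
    goes into the hazard rate of F. Dividing by 1 - G cancels one of the two denominators
    \<open>odds_denom\<close>.\<close>
  moreover have "1 + F x / (1 - F x) = 1 / (1 - F x)"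
    using assms by (simp add: field_simps)
  ultimately show ?thesis
    using assms
    by (simp add: hazard_rate_def g_eq G_eq_tilt tilt_def tilt_deriv_def hazard_factor_def
        power2_eq_square ac_simps)
qed

lemma odds_mono:
  assumes "x \<le> y" "F y < 1"
  shows "F x / (1 - F x) \<le> F y / (1 - F y)"
  using assms monoD[OF mono_F, of x y] F_bounds(1) by (intro frac_le) auto

lemma hazard_factor_odds_nonneg:
  assumes "F x < 1"
  shows "0 \<le> hazard_factor \<alpha> \<beta> \<theta> (F x / (1 - F x))"
  using assms F_bounds(1)[of x] odds_denom_ge_1[of "F x / (1 - F x)"]
  by (intro hazard_factor_nonneg) auto

lemma hazard_rate_nonneg: "0 \<le> hazard_rate F f x"
  using has_densityD(2)[OF F] F_bounds(2)[of x] by (simp add: hazard_rate_def)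

text \<open>The hazard rate of G is a positive constant times two nonnegative increasing functions:
  k at the odds of F, and the hazard rate of F. Nonnegativity of both is what lets the two
  inequalities be multiplied.\<close>

lemma increasing_hazard_rate_G:
  assumes D: "\<And>t. 0 < t \<Longrightarrow> D \<alpha> \<beta> \<theta> t \<le> 0" and "increasing_hazard_rate F f"
  shows "increasing_hazard_rate G g"
  unfolding increasing_hazard_rate_def
proof (intro conjI has_density_G mono_onI)
  fix x y :: real
  assume "x \<in> {x. 0 < G x \<and> G x < 1}" "y \<in> {x. 0 < G x \<and> G x < 1}" and xy: "x \<le> y"
  then have xy': "0 < F x" "F x < 1" "0 < F y" "F y < 1"
    using support_G by auto
  have "hazard_rate F f x \<le> hazard_rate F f y"
    using assms(2) xy xy' by (auto simp: increasing_hazard_rate_def monotone_on_def)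
  moreover have "hazard_factor \<alpha> \<beta> \<theta> (F x / (1 - F x)) \<le> hazard_factor \<alpha> \<beta> \<theta> (F y / (1 - F y))"
    using xy xy' by (intro hazard_factor_mono D odds_mono) auto
  ultimately show "hazard_rate G g x \<le> hazard_rate G g y"
    using xy' \<beta> \<theta>
    by (simp add: hazard_rate_G mult_mono hazard_factor_odds_nonneg hazard_rate_nonneg)
qed

lemma decreasing_hazard_rate_G:
  assumes D: "\<And>t. 0 < t \<Longrightarrow> 0 \<le> D \<alpha> \<beta> \<theta> t" and "decreasing_hazard_rate F f"
  shows "decreasing_hazard_rate G g"
  unfolding decreasing_hazard_rate_def
proof (intro conjI has_density_G monotone_onI)
  fix x y :: real
  assume "x \<in> {x. 0 < G x \<and> G x < 1}" "y \<in> {x. 0 < G x \<and> G x < 1}" and xy: "x \<le> y"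
  then have xy': "0 < F x" "F x < 1" "0 < F y" "F y < 1"
    using support_G by auto
  have "hazard_rate F f y \<le> hazard_rate F f x"
    using assms(2) xy xy' by (auto simp: decreasing_hazard_rate_def monotone_on_def)
  moreover have "hazard_factor \<alpha> \<beta> \<theta> (F y / (1 - F y)) \<le> hazard_factor \<alpha> \<beta> \<theta> (F x / (1 - F x))"
    using xy xy' by (intro hazard_factor_antimono D odds_mono) auto
  ultimately show "hazard_rate G g y \<le> hazard_rate G g x"
    using xy' \<beta> \<theta>
    by (simp add: hazard_rate_G mult_mono hazard_factor_odds_nonneg hazard_rate_nonneg)
qed

end

end

theorem theorem4p5:
  fixes \<alpha> \<beta> \<theta> :: real
    and F f G g :: "real \<Rightarrow> real"
  assumes "0 \<le> \<alpha>" and "0 < \<beta>" and "0 < \<theta>"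
    and "has_density F f"
    and "distribution_function G"
    and "\<And>x. odds G x = odds_transform \<alpha> \<beta> \<theta> (odds F x)"
    and "g = transformed_density \<alpha> \<beta> \<theta> F f G"
  shows
    "D \<alpha> \<beta> \<theta> 0 = \<alpha> powr \<theta> * \<beta> * \<theta> - \<alpha> - (\<theta> - 1) \<and>
     (D \<alpha> \<beta> \<theta> 0 < 0 \<and> (1 - \<alpha>) * (\<theta> - 1) < 0 \<and> increasing_hazard_rate F f
        \<longrightarrow> increasing_hazard_rate G g) \<and>
     (D \<alpha> \<beta> \<theta> 0 > 0 \<and> (1 - \<alpha>) * (\<theta> - 1) > 0 \<and> decreasing_hazard_rate F f
        \<longrightarrow> decreasing_hazard_rate G g) \<and>
     ((\<alpha> = 1 \<or> \<theta> = 1) \<and> \<beta> \<le> 1 \<and> increasing_hazard_rate F f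
        \<longrightarrow> increasing_hazard_rate G g) \<and>
     ((\<alpha> = 1 \<or> \<theta> = 1) \<and> \<beta> \<ge> 1 \<and> decreasing_hazard_rate F f
        \<longrightarrow> decreasing_hazard_rate G g)"
proof (intro conjI impI; (elim conjE)?)
  note params = assms(1-3)
  note inc = increasing_hazard_rate_G[OF assms]
  note dec = decreasing_hazard_rate_G[OF assms]
  show "D \<alpha> \<beta> \<theta> 0 = \<alpha> powr \<theta> * \<beta> * \<theta> - \<alpha> - (\<theta> - 1)"
    by (rule D_0[OF params])
  show "increasing_hazard_rate G g"
    if "D \<alpha> \<beta> \<theta> 0 < 0" "(1 - \<alpha>) * (\<theta> - 1) < 0" "increasing_hazard_rate F f"
    using that by (intro inc D_le_0[OF params])
  show "decreasing_hazard_rate G g"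
    if "D \<alpha> \<beta> \<theta> 0 > 0" "(1 - \<alpha>) * (\<theta> - 1) > 0" "decreasing_hazard_rate F f"
    using that by (intro dec D_ge_0[OF params])
  show "increasing_hazard_rate G g"
    if "\<alpha> = 1 \<or> \<theta> = 1" "\<beta> \<le> 1" "increasing_hazard_rate F f"
    using that D_boundary_factor_nonneg[OF params that(1)]
    by (intro inc) (simp_all add: D_boundary[OF params that(1)] mult_nonpos_nonneg)
  show "decreasing_hazard_rate G g"
    if "\<alpha> = 1 \<or> \<theta> = 1" "\<beta> \<ge> 1" "decreasing_hazard_rate F f"
    using that D_boundary_factor_nonneg[OF params that(1)]
    by (intro dec) (simp_all add: D_boundary[OF params that(1)])
qed

end
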